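(* Let $\mu$ be the vector of market weights and $A\in CBV([0,T],\mathbb{R}^m)$. Let $G:\mathbb{R}^d\times\mathbb{R}^m\to[0,\infty)$ be regular for the pair $(\mu,A)$ and such that $\Gamma^G(\cdot)$ is nondecreasing on $[0,T]$. Suppose that for some real number $T_*\in(0,T]$ $$\Gamma^G(T_* )>G(\mu(0),A(0)).$$ Then the trading strategy $\varphi$ additively generated by $G$ is strong arbitrage relative to the market over every time horizon $[0,t]$ with $T_*\le t\le T$.
   Context: Partitions: $T>0$ is fixed, and $(\mathbb{T}_n)_{n\in\mathbb{N}}$ is a fixed sequence of finite partitions of $[0,T]$ (containing $0$ and $T$) with $\mathbb{T}_1\subset\mathbb{T}_2\subset\cdots$ and mesh tending to $0$. $[t_j,t_{j+1}]\in\mathbb{T}_n$ means that $t_j<t_{j+1}$ are consecutive points of $\mathbb{T}_n$; in sums over $[t_j,t_{j+1}]\in\mathbb{T}_n$ with $t_j\le t$, $t_{j+1}$ is replaced by $t$ when $j$ is the largest index with $t_j\le t$. Market weights: $S_1,\dots,S_d:[0,T]\to[0,\infty)$ ($d\ge2$) are continuous with $S_i(0)>0$ and $S_1(t)+\dots+S_d(t)>0$ for all $t$; $\mu_i(t)=S_i(t)/(S_1(t)+\dots+S_d(t))$. It is assumed that $\mu$ has pathwise quadratic covariations along $(\mathbb{T}_n)$: for all $i,k$ and $t$ the limit $\langle\mu_i,\mu_k\rangle(t)=\lim_n\sum_{[t_j,t_{j+1}]\in\mathbb{T}_n,\,t_j\le t}(\mu_i(t_{j+1})-\mu_i(t_j))(\mu_k(t_{j+1})-\mu_k(t_j))$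 exists and is real-valued and continuous in $t$. $CBV([0,T],\mathbb{R}^m)$: continuous $\mathbb{R}^m$-valued functions of bounded variation on $[0,T]$. $\mathbb{C}^{2,1}$: functions on $\mathbb{R}^{d+m}$ twice continuously differentiable in the first $d$ variables and once continuously differentiable in the last $m$ variables; $\partial_i$ denotes the derivative in the $i$-th of the first $d$ variables. Integral: $\int_0^t\sum_{i=1}^d\partial_iG(\mu(s),A(s))\,d\mu_i(s):=\lim_{n}\sum_{[t_j,t_{j+1}]\in\mathbb{T}_n,\,t_j\le t}\sum_{i=1}^d\partial_iG(\mu(t_j),A(t_j))(\mu_i(t_{j+1})-\mu_i(t_j))$ (the limit exists by the pathwise Itô formula). Regular function: $G\in\mathbb{C}^{2,1}$ is regular for $(\mu,A)$ if $\Gamma^G(t):=G(\mu(0),A(0))-G(\mu(t),A(t))+\int_0^t\sum_i\partial_iG(\mu(s),A(s))\,d\mu_i(s)$, $0\le t\le T$, has finite variation on compact intervals of $[0,T]$. Additive generation: put $\vartheta_i(t)=\partial_iG(\mu(t),A(t))$, $V^\vartheta(t)=\sum_i\vartheta_i(t)\mu_i(t)$, $Q^\vartheta(t)=V^\vartheta(t)-V^\vartheta(0)-\int_0^t\sum_i\vartheta_i(s)\,d\mu_i(s)$, and $C(0)=\sum_i\partial_iG(\mu(0),A(0))\mu_i(0)-G(\mu(0),A(0))$. The trading strategy additively generated by $G$ is $\varphi_i(t)=\vartheta_i(t)-Q^\vartheta(t)-C(0)$, $i=1,\dots,d$; its value is $V^\varphi(t)=\sum_i\varphi_i(t)\mu_i(t)$.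 Strong relative arbitrage: a trading strategy $\varphi$ is strong arbitrage relative to the market over $[0,t]$, $t\in(0,T]$, if $V^\varphi(s)\ge0$ for all $s\in[0,t]$ and $V^\varphi(t)>V^\varphi(0)$. *)

theory Defs
  imports "HOL-Analysis.Analysis"
begin

section \<open>Partitions\<close>

definition intervals :: "real set \<Rightarrow> (real \<times> real) set" where
  "intervals P = {(u, v). u \<in> P \<and> v \<in> P \<and> u < v \<and> P \<inter> {u<..<v} = {}}"

definition mesh :: "real set \<Rightarrow> real" where
  "mesh P = Max ((\<lambda>(u, v). v - u) ` intervals P)"

definition partition_of :: "real \<Rightarrow> real set \<Rightarrow> bool" where
  "partition_of T P \<longleftrightarrow> finite P \<and> P \<subseteq> {0..T} \<and> 0 \<in> P \<and> T \<in> P"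

definition refining_partitions :: "real \<Rightarrow> (nat \<Rightarrow> real set) \<Rightarrow> bool" where
  "refining_partitions T \<T> \<longleftrightarrow>
     (\<forall>n. partition_of T (\<T> n)) \<and> (\<forall>n. \<T> n \<subseteq> \<T> (Suc n)) \<and> (\<lambda>n. mesh (\<T> n)) \<longlonglongrightarrow> 0"

definition intervals_upto :: "real set \<Rightarrow> real \<Rightarrow> (real \<times> real) set" where
  "intervals_upto P t = {(u, v) \<in> intervals P. u \<le> t}"

section \<open>Functions of bounded variation\<close>

definition bounded_variation_on :: "real \<Rightarrow> real \<Rightarrow> (real \<Rightarrow> 'a::real_normed_vector) \<Rightarrow> bool" where
  "bounded_variation_on a b f \<longleftrightarrow>
     (\<exists>B. \<forall>P. finite P \<and> P \<subseteq> {a..b} \<longrightarrow> (\<Sum>(u, v)\<in>intervals P. norm (f v - f u)) \<le> B)"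

definition CBV :: "real \<Rightarrow> (real \<Rightarrow> 'a::real_normed_vector) set" where
  "CBV T = {A. continuous_on {0..T} A \<and> bounded_variation_on 0 T A}"

section \<open>Market weights\<close>

definition market :: "real \<Rightarrow> (real \<Rightarrow> real ^ 'd) \<Rightarrow> bool" where
  "market T S \<longleftrightarrow> continuous_on {0..T} S \<and> (\<forall>t\<in>{0..T}. \<forall>i. S t $ i \<ge> 0) \<and>
     (\<forall>i. S 0 $ i > 0) \<and> (\<forall>t\<in>{0..T}. (\<Sum>i\<in>UNIV. S t $ i) > 0)"

definition market_weights :: "(real \<Rightarrow> real ^ 'd) \<Rightarrow> real \<Rightarrow> real ^ 'd" where
  "market_weights S t = (\<chi> i. S t $ i / (\<Sum>k\<in>UNIV. S t $ k))"

text \<open>For consecutive partition points \<open>u \<le> t\<close> and \<open>v\<close> one has \<open>v > t\<close> exactly when \<open>u\<close> is the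
  last partition point up to \<open>t\<close> (and \<open>t\<close> is not the right end point), so \<open>min v t\<close> replaces the
  right end point by \<open>t\<close> in the last interval only.\<close>

definition has_covariations ::
    "real \<Rightarrow> (nat \<Rightarrow> real set) \<Rightarrow> (real \<Rightarrow> real ^ 'd) \<Rightarrow> bool" where
  "has_covariations T \<T> \<mu> \<longleftrightarrow>
     (\<forall>i k. \<exists>Q. continuous_on {0..T} Q \<and>
       (\<forall>t\<in>{0..T}. (\<lambda>n. \<Sum>(u, v)\<in>intervals_upto (\<T> n) t.
          (\<mu> (min v t) $ i - \<mu> u $ i) * (\<mu> (min v t) $ k - \<mu> u $ k)) \<longlonglongrightarrow> Q t))"

text \<open>The limit below is meant for integrands for which it exists; for gradients of \<open>C\<^sup>2\<^sup>,\<^sup>1\<close> functions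
  along \<open>(\<mu>, A)\<close>, with \<open>A\<close> in \<open>CBV\<close>, existence is the pathwise Ito formula.\<close>

definition pathwise_integral ::
    "(nat \<Rightarrow> real set) \<Rightarrow> (real \<Rightarrow> real ^ 'd) \<Rightarrow> (real \<Rightarrow> real ^ 'd) \<Rightarrow> real \<Rightarrow> real" where
  "pathwise_integral \<T> \<theta> \<mu> t =
     lim (\<lambda>n. \<Sum>(u, v)\<in>intervals_upto (\<T> n) t. \<Sum>i\<in>UNIV. \<theta> u $ i * (\<mu> (min v t) $ i - \<mu> u $ i))"

section \<open>Functions of class \<open>C\<^sup>2\<^sup>,\<^sup>1\<close>\<close>

definition partial1 :: "'d::finite \<Rightarrow> ((real ^ 'd) \<times> (real ^ 'm) \<Rightarrow> real) \<Rightarrow> (real ^ 'd) \<times> (real ^ 'm) \<Rightarrow> real" where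
  "partial1 i G = (\<lambda>(x, a). deriv (\<lambda>h. G (x + h *\<^sub>R axis i 1, a)) 0)"

definition partial2 :: "'m::finite \<Rightarrow> ((real ^ 'd) \<times> (real ^ 'm) \<Rightarrow> real) \<Rightarrow> (real ^ 'd) \<times> (real ^ 'm) \<Rightarrow> real" where
  "partial2 l G = (\<lambda>(x, a). deriv (\<lambda>h. G (x, a + h *\<^sub>R axis l 1)) 0)"

definition C1_first :: "((real ^ 'd) \<times> (real ^ 'm) \<Rightarrow> real) \<Rightarrow> bool" where
  "C1_first G \<longleftrightarrow>
     (\<forall>i x a. (\<lambda>h. G (x + h *\<^sub>R axis i 1, a)) field_differentiable at 0) \<and>
     (\<forall>i. continuous_on UNIV (partial1 i G))"

definition C1_second :: "((real ^ 'd) \<times> (real ^ 'm) \<Rightarrow> real) \<Rightarrow> bool" where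
  "C1_second G \<longleftrightarrow>
     (\<forall>l x a. (\<lambda>h. G (x, a + h *\<^sub>R axis l 1)) field_differentiable at 0) \<and>
     (\<forall>l. continuous_on UNIV (partial2 l G))"

definition C21 :: "((real ^ 'd) \<times> (real ^ 'm) \<Rightarrow> real) \<Rightarrow> bool" where
  "C21 G \<longleftrightarrow> continuous_on UNIV G \<and> C1_first G \<and> (\<forall>i. C1_first (partial1 i G)) \<and> C1_second G"

section \<open>Regular functions and generated strategies\<close>

definition grad_strategy ::
    "((real ^ 'd) \<times> (real ^ 'm) \<Rightarrow> real) \<Rightarrow> (real \<Rightarrow> real ^ 'd) \<Rightarrow> (real \<Rightarrow> real ^ 'm) \<Rightarrow> real \<Rightarrow> real ^ 'd" where
  "grad_strategy G \<mu> A t = (\<chi> i. partial1 i G (\<mu> t, A t))"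

definition Gam ::
    "(nat \<Rightarrow> real set) \<Rightarrow> ((real ^ 'd) \<times> (real ^ 'm) \<Rightarrow> real) \<Rightarrow> (real \<Rightarrow> real ^ 'd) \<Rightarrow>
      (real \<Rightarrow> real ^ 'm) \<Rightarrow> real \<Rightarrow> real" where
  "Gam \<T> G \<mu> A t =
     G (\<mu> 0, A 0) - G (\<mu> t, A t) + pathwise_integral \<T> (grad_strategy G \<mu> A) \<mu> t"

definition regular ::
    "real \<Rightarrow> (nat \<Rightarrow> real set) \<Rightarrow> ((real ^ 'd) \<times> (real ^ 'm) \<Rightarrow> real) \<Rightarrow> (real \<Rightarrow> real ^ 'd) \<Rightarrow>
      (real \<Rightarrow> real ^ 'm) \<Rightarrow> bool" where
  "regular T \<T> G \<mu> A \<longleftrightarrow> C21 G \<and> bounded_variation_on 0 T (Gam \<T> G \<mu> A)"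

definition wealth :: "(real \<Rightarrow> real ^ 'd) \<Rightarrow> (real \<Rightarrow> real ^ 'd) \<Rightarrow> real \<Rightarrow> real" where
  "wealth \<mu> \<phi> t = (\<Sum>i\<in>UNIV. \<phi> t $ i * \<mu> t $ i)"

definition defect ::
    "(nat \<Rightarrow> real set) \<Rightarrow> (real \<Rightarrow> real ^ 'd) \<Rightarrow> (real \<Rightarrow> real ^ 'd) \<Rightarrow> real \<Rightarrow> real" where
  "defect \<T> \<mu> \<theta> t = wealth \<mu> \<theta> t - wealth \<mu> \<theta> 0 - pathwise_integral \<T> \<theta> \<mu> t"

definition additively_generated ::
    "(nat \<Rightarrow> real set) \<Rightarrow> ((real ^ 'd) \<times> (real ^ 'm) \<Rightarrow> real) \<Rightarrow> (real \<Rightarrow> real ^ 'd) \<Rightarrow>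
      (real \<Rightarrow> real ^ 'm) \<Rightarrow> real \<Rightarrow> real ^ 'd" where
  "additively_generated \<T> G \<mu> A t =
     (let \<theta> = grad_strategy G \<mu> A;
          C0 = (\<Sum>i\<in>UNIV. partial1 i G (\<mu> 0, A 0) * \<mu> 0 $ i) - G (\<mu> 0, A 0)
      in (\<chi> i. \<theta> t $ i - defect \<T> \<mu> \<theta> t - C0))"

section \<open>Strong relative arbitrage\<close>

text \<open>A trading strategy is a self-financing integrand: changes in wealth are trading gains.\<close>

definition trading_strategy ::
    "real \<Rightarrow> (nat \<Rightarrow> real set) \<Rightarrow> (real \<Rightarrow> real ^ 'd) \<Rightarrow> (real \<Rightarrow> real ^ 'd) \<Rightarrow> bool" where
  "trading_strategy T \<T> \<mu> \<phi> \<longleftrightarrow>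
     (\<forall>t\<in>{0..T}. wealth \<mu> \<phi> t - wealth \<mu> \<phi> 0 = pathwise_integral \<T> \<phi> \<mu> t)"

definition strong_relative_arbitrage ::
    "real \<Rightarrow> (nat \<Rightarrow> real set) \<Rightarrow> (real \<Rightarrow> real ^ 'd) \<Rightarrow> (real \<Rightarrow> real ^ 'd) \<Rightarrow> real \<Rightarrow> bool" where
  "strong_relative_arbitrage T \<T> \<mu> \<phi> t \<longleftrightarrow>
     trading_strategy T \<T> \<mu> \<phi> \<and> t \<in> {0<..T} \<and>
     (\<forall>s\<in>{0..t}. wealth \<mu> \<phi> s \<ge> 0) \<and> wealth \<mu> \<phi> t > wealth \<mu> \<phi> 0"

end

theory Submission
  imports Defs
begin

text \<open>Since the market weights sum to one, shifting every component of an integrand by the same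
  scalar leaves all its Riemann sums unchanged. The strategy generated by \<open>G\<close> is such a shift of
  the gradient, hence is self-financing, and its wealth equals \<open>\<Gamma>\<^sup>G(t) + G(\<mu>(t), A(t))\<close>. Monotonicity
  of \<open>\<Gamma>\<^sup>G\<close>, \<open>\<Gamma>\<^sup>G(0) = 0\<close> and \<open>G \<ge> 0\<close> give the claim.\<close>

lemma sum_market_weights:
  assumes "market T S" and "t \<in> {0..T}"
  shows "(\<Sum>i\<in>UNIV. market_weights S t $ i) = 1"
proof -
  have "(\<Sum>k\<in>UNIV. S t $ k) > 0"
    using assms by (auto simp: market_def)
  then show ?thesis
    by (simp add: market_weights_def flip: sum_divide_distrib)
qed

text \<open>The only interval that enters starts at \<open>0\<close>, and its right end is cut back
  to \<open>0\<close>, so each Riemann sum vanishes. This is what makes \<open>Gam\<close> start at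
  zero.\<close>

lemma pathwise_integral_0:
  assumes "\<And>n. partition_of T (\<T> n)"
  shows "pathwise_integral \<T> \<theta> \<mu> 0 = 0"
proof -
  have "(\<Sum>(u, v)\<in>intervals_upto (\<T> n) 0. \<Sum>i\<in>UNIV. \<theta> u $ i * (\<mu> (min v 0) $ i - \<mu> u $ i)) = 0" for n
  proof (rule sum.neutral, clarify)
    fix u v assume "(u, v) \<in> intervals_upto (\<T> n) 0"
    then have "u = 0" "min v 0 = 0"
      using assms[of n] by (auto simp: intervals_upto_def intervals_def partition_of_def)
    then show "(\<Sum>i\<in>UNIV. \<theta> u $ i * (\<mu> (min v 0) $ i - \<mu> u $ i)) = 0"
      by simp
  qed
  then show ?thesis
    by (simp add: pathwise_integral_def limI)
qed

text \<open>The shift may vary in time: within one interval only \<open>c u\<close> occurs, and it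
  factors out of the sum over \<open>i\<close>, where the increments of \<open>\<mu>\<close> add up
  to \<open>1 - 1\<close>. Both sides are thus \<open>lim\<close> of the same sequence.\<close>

lemma pathwise_integral_shift:
  assumes "\<And>n. partition_of T (\<T> n)"
    and "\<And>s. s \<in> {0..T} \<Longrightarrow> (\<Sum>i\<in>UNIV. \<mu> s $ i) = 1"
    and "t \<in> {0..T}"
  shows "pathwise_integral \<T> (\<lambda>s. \<chi> i. \<theta> s $ i - c s) \<mu> t = pathwise_integral \<T> \<theta> \<mu> t"
proof -
  have step: "(\<Sum>i\<in>UNIV. (\<theta> u $ i - c u) * (\<mu> (min v t) $ i - \<mu> u $ i)) =
        (\<Sum>i\<in>UNIV. \<theta> u $ i * (\<mu> (min v t) $ i - \<mu> u $ i))"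
    if "(u, v) \<in> intervals_upto (\<T> n) t" for n u v
  proof -
    have "u \<in> {0..T}" "min v t \<in> {0..T}"
      using that assms(1)[of n] assms(3)
      by (auto simp: intervals_upto_def intervals_def partition_of_def)
    then have "(\<Sum>i\<in>UNIV. \<mu> (min v t) $ i - \<mu> u $ i) = 0"
      using assms(2) by (simp add: sum_subtractf)
    then show ?thesis
      by (simp add: left_diff_distrib sum_subtractf flip: sum_distrib_left right_diff_distrib)
  qed
  have "(\<Sum>(u, v)\<in>intervals_upto (\<T> n) t. \<Sum>i\<in>UNIV. (\<theta> u $ i - c u) * (\<mu> (min v t) $ i - \<mu> u $ i)) =
        (\<Sum>(u, v)\<in>intervals_upto (\<T> n) t. \<Sum>i\<in>UNIV. \<theta> u $ i * (\<mu> (min v t) $ i - \<mu> u $ i))" for n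
    by (rule sum.cong[OF refl]) (clarify, rule step)
  then show ?thesis
    by (simp add: pathwise_integral_def)
qed

lemma wealth_shift:
  assumes "(\<Sum>i\<in>UNIV. \<mu> t $ i) = 1"
  shows "wealth \<mu> (\<lambda>s. \<chi> i. \<theta> s $ i - c s) t = wealth \<mu> \<theta> t - c t"
  using assms by (simp add: wealth_def left_diff_distrib sum_subtractf flip: sum_distrib_left)

text \<open>Puts the strategy into the form that both shift lemmas match; the last two terms of the
  shift are the constant \<open>C0\<close>.\<close>

lemma additively_generated_eq_shift:
  "additively_generated \<T> G \<mu> A = (\<lambda>t. \<chi> i. grad_strategy G \<mu> A t $ i -
     (defect \<T> \<mu> (grad_strategy G \<mu> A) t + wealth \<mu> (grad_strategy G \<mu> A) 0 - G (\<mu> 0, A 0)))"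
  by (rule ext) (simp add: additively_generated_def Let_def wealth_def grad_strategy_def vec_eq_iff)

text \<open>Subtracting \<open>defect\<close> and \<open>C0\<close> cancels the gradient's own
  wealth at times \<open>t\<close> and \<open>0\<close>; what remains is
  \<open>G (\<mu> 0, A 0)\<close> plus the integral.\<close>

lemma wealth_additively_generated:
  assumes "(\<Sum>i\<in>UNIV. \<mu> t $ i) = 1"
  shows "wealth \<mu> (additively_generated \<T> G \<mu> A) t = Gam \<T> G \<mu> A t + G (\<mu> t, A t)"
  by (simp add: additively_generated_eq_shift wealth_shift assms defect_def Gam_def)

theorem theorem4p2:
  fixes T Tstar :: real
    and \<T> :: "nat \<Rightarrow> real set"
    and S \<mu> :: "real \<Rightarrow> real ^ 'd"
    and A :: "real \<Rightarrow> real ^ 'm"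
    and G :: "(real ^ 'd) \<times> (real ^ 'm) \<Rightarrow> real"
  assumes "T > 0"
    and "CARD('d) \<ge> 2"
    and "refining_partitions T \<T>"
    and "market T S"
    and "\<mu> = market_weights S"
    and "has_covariations T \<T> \<mu>"
    and "A \<in> CBV T"
    and "\<forall>z. G z \<ge> 0"
    and "regular T \<T> G \<mu> A"
    and "mono_on {0..T} (Gam \<T> G \<mu> A)"
    and "Tstar \<in> {0<..T}"
    and "Gam \<T> G \<mu> A Tstar > G (\<mu> 0, A 0)"
  shows "\<forall>t\<in>{Tstar..T}.
           strong_relative_arbitrage T \<T> \<mu> (additively_generated \<T> G \<mu> A) t"
proof -
  let ?\<phi> = "additively_generated \<T> G \<mu> A"
  have part: "\<And>n. partition_of T (\<T> n)"
    using assms(3) by (simp add: refining_partitions_def)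
  have one: "\<And>s. s \<in> {0..T} \<Longrightarrow> (\<Sum>i\<in>UNIV. \<mu> s $ i) = 1"
    using assms(4,5) by (simp add: sum_market_weights)
  have wealth: "wealth \<mu> ?\<phi> s = Gam \<T> G \<mu> A s + G (\<mu> s, A s)" if "s \<in> {0..T}" for s
    using one[OF that] by (rule wealth_additively_generated)
  have Gam0: "Gam \<T> G \<mu> A 0 = 0"
    by (simp add: Gam_def pathwise_integral_0[OF part])
  have wealth0: "wealth \<mu> ?\<phi> 0 = G (\<mu> 0, A 0)"
    using wealth[of 0] Gam0 \<open>T > 0\<close> by simp
  have mono: "Gam \<T> G \<mu> A r \<le> Gam \<T> G \<mu> A s" if "0 \<le> r" "r \<le> s" "s \<le> T" for r s
    using mono_onD[OF assms(10), of r s] that by simp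
  have nonneg: "wealth \<mu> ?\<phi> s \<ge> 0" if "s \<in> {0..T}" for s
    using wealth[OF that] mono[of 0 s] Gam0 assms(8) that by simp
  have "pathwise_integral \<T> ?\<phi> \<mu> s = pathwise_integral \<T> (grad_strategy G \<mu> A) \<mu> s"
    if "s \<in> {0..T}" for s
    unfolding additively_generated_eq_shift by (rule pathwise_integral_shift[OF part one that])
  \<comment> \<open>By \<open>wealth\<close> and \<open>wealth0\<close>, the change in wealth is the
    integral of the gradient, which was just identified with the integral of the strategy
    itself.\<close>
  then have self_financing: "trading_strategy T \<T> \<mu> ?\<phi>"
    by (simp add: trading_strategy_def wealth wealth0 Gam_def)
  show ?thesis
  proof
    fix t assume t: "t \<in> {Tstar..T}"
    \<comment> \<open>The initial wealth is exactly the threshold assumed at \<open>Tstar\<close>;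
      strictness enters here, and the last link of the chain adds the nonnegative
      \<open>G (\<mu> t, A t)\<close>.\<close>
    have "wealth \<mu> ?\<phi> 0 < Gam \<T> G \<mu> A Tstar"
      using assms(12) wealth0 by simp
    also have "\<dots> \<le> Gam \<T> G \<mu> A t"
      using mono t assms(11) by simp
    also have "\<dots> \<le> wealth \<mu> ?\<phi> t"
      using wealth[of t] t assms(8,11) by simp
    finally show "strong_relative_arbitrage T \<T> \<mu> ?\<phi> t"
      using self_financing nonneg t assms(11) by (simp add: strong_relative_arbitrage_def)
  qed
qed

end
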